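(* Let $G=(V,E)$ be a digraph, $\bar s\in\mathbb{Z}_+$, $S=\{1,\dots,\bar s\}$, and $D$ a set of demands, and let $RSA(G,D,\bar s)$ be the polytope described in the context. Let $a\cdot u\le b$, i.e. $\sum_{d\in D}\sum_{e\in E}\sum_{s\in S} a_{des}u_{des}\le b$, be a valid inequality (resp., an optimality cut) for $RSA(G,D,\bar s)$. Then the slot-symmetrical inequality $$\sum_{d\in D}\sum_{e\in E}\sum_{s\in S} a_{des}\, u_{de,\bar s-s+1}\le b$$ is also valid (resp., an optimality cut) for $RSA(G,D,\bar s)$. Furthermore, if $a\cdot u\le b$ induces a facet of $RSA(G,D,\bar s)$, then the slot-symmetrical inequality also induces a facet of this polytope.
   Context: Routing and spectrum allocation (RSA) setting: $G=(V,E)$ is a digraph, $\bar s\in\mathbb{Z}_+$ is the number of available slots, $S=\{1,\dots,\bar s\}$, and $D$ is a finite set of demands, each $d\in D$ being a triple $(s(d),t(d),v(d))$ with source $s(d)\in V$, target $t(d)\in V$ and volume $v(d)\in\mathbb{Z}_+$. For $j\in V$, $\delta^-(j)$ and $\delta^+(j)$ denote the sets of incoming and outgoing arcs of $j$, and $\delta(j)=\delta^-(j)\cup\delta^+(j)$. There is a binary variable $u_{des}$ for each $d\in D$, $e\in E$, $s\in S$ (meaning demand $d$ uses slot $s$ on arc $e$), together with fictitious variables $u_{de,\bar s+1}$ fixed to $0$. The DSL-BF formulation is: minimize $\sum_{d\in D}\sum_{e\in E}\sum_{s\in S}u_{des}/v(d)$ subject to (i) $\sum_{e\in\delta^-(j)}u_{des}-\sum_{e\in\delta^+(j)}u_{des}=0$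 for all $d\in D$, $j\in V\setminus\{s(d),t(d)\}$, $s\in S$; (ii) $\sum_{e\in\delta^+(s(d))}\sum_{s\in S}u_{des}\ge v(d)$ for all $d\in D$; (iii) $\sum_{e\in\delta^-(s(d))}\sum_{s\in S}u_{des}=0$ for all $d\in D$; (iv) $\sum_{d\in D}u_{des}\le 1$ for all $e\in E$, $s\in S$; (v) $v(d)(u_{des}-u_{de,s+1})\le\sum_{s'=f}^{s}u_{des'}$ for all $d\in D$, $e\in E$, $s\in S$, where $f=\max\{1,s-v(d)+1\}$; (vi) $u_{des}\in\{0,1\}$ for all $d,e,s$. $RSA(G,D,\bar s)$ is the convex hull of the feasible solutions of (i)–(vi). A valid inequality is a linear inequality in $u$ satisfied by all points of $RSA(G,D,\bar s)$. An optimality cut is a linear inequality that is not valid but does not remove all optimal solutions of the DSL-BF formulation (i.e., some optimal solution satisfies it). *)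

theory Defs
  imports
    "HOL-Analysis.Analysis"
    "HOL-Analysis.Finite_Function_Topology"
    "Graph_Theory.Digraph"
begin

text \<open>
  A demand is a triple (source, target, volume). The record is extensible, so that distinct
  demands may also share the same triple (by carrying different labels in the extension).
\<close>

record 'v demand =
  source :: 'v
  target :: 'v
  volume :: nat

text \<open>
  The volume of a demand is positive, since the objective function divides by it.
  Parallel arcs and loops are allowed.
\<close>

locale rsa_instance = fin_digraph G
  for G :: "('v, 'e) pre_digraph" +
  fixes D :: "('v, 'x) demand_scheme set"
  assumes finite_demands: "finite D"
    and source_in_verts: "d \<in> D \<Longrightarrow> source d \<in> verts G"
    and target_in_verts: "d \<in> D \<Longrightarrow> target d \<in> verts G"
    and volume_pos: "d \<in> D \<Longrightarrow> volume d > 0"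

text \<open>
  The space of the variables $u_{des}$ depends on the sets $D$, $E$ and on the number of slots.
  Its points are represented by finitely supported functions of $(d, e, s)$ that vanish
  outside $D \times E \times S$. In particular the fictitious variables for the slot after
  the last one are $0$, and the dimension below is the one in $\mathbb{R}^{D \times E \times S}$.
\<close>

type_synonym ('v, 'x, 'e) point = "(('v, 'x) demand_scheme \<times> 'e \<times> nat) \<Rightarrow>\<^sub>0 real"

abbreviation var :: "('v, 'x, 'e) point \<Rightarrow> ('v, 'x) demand_scheme \<Rightarrow> 'e \<Rightarrow> nat \<Rightarrow> real" where
  "var u d e s \<equiv> Poly_Mapping.lookup u (d, e, s)"

definition dsl_bf ::
  "('v, 'e) pre_digraph \<Rightarrow> ('v, 'x) demand_scheme set \<Rightarrow> nat \<Rightarrow> ('v, 'x, 'e) point set" where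
  "dsl_bf G D sbar = {u. Poly_Mapping.keys u \<subseteq> D \<times> arcs G \<times> {1..sbar} \<and>
    (\<forall>d\<in>D. \<forall>j\<in>verts G - {source d, target d}. \<forall>s\<in>{1..sbar}.
       (\<Sum>e\<in>in_arcs G j. var u d e s) - (\<Sum>e\<in>out_arcs G j. var u d e s) = 0) \<and>
    (\<forall>d\<in>D. (\<Sum>e\<in>out_arcs G (source d). \<Sum>s\<in>{1..sbar}. var u d e s) \<ge> real (volume d)) \<and>
    (\<forall>d\<in>D. (\<Sum>e\<in>in_arcs G (source d). \<Sum>s\<in>{1..sbar}. var u d e s) = 0) \<and>
    (\<forall>e\<in>arcs G. \<forall>s\<in>{1..sbar}. (\<Sum>d\<in>D. var u d e s) \<le> 1) \<and>
    (\<forall>d\<in>D. \<forall>e\<in>arcs G. \<forall>s\<in>{1..sbar}.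
       real (volume d) * (var u d e s - var u d e (s + 1))
         \<le> (\<Sum>s'\<in>{max 1 (s + 1 - volume d)..s}. var u d e s')) \<and>
    (\<forall>d\<in>D. \<forall>e\<in>arcs G. \<forall>s\<in>{1..sbar}. var u d e s \<in> {0, 1})}"

definition dsl_bf_cost ::
  "('v, 'e) pre_digraph \<Rightarrow> ('v, 'x) demand_scheme set \<Rightarrow> nat \<Rightarrow> ('v, 'x, 'e) point \<Rightarrow> real" where
  "dsl_bf_cost G D sbar u =
    (\<Sum>d\<in>D. \<Sum>e\<in>arcs G. \<Sum>s\<in>{1..sbar}. var u d e s / real (volume d))"

definition dsl_bf_optimal ::
  "('v, 'e) pre_digraph \<Rightarrow> ('v, 'x) demand_scheme set \<Rightarrow> nat \<Rightarrow> ('v, 'x, 'e) point \<Rightarrow> bool" where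
  "dsl_bf_optimal G D sbar u \<longleftrightarrow>
    u \<in> dsl_bf G D sbar \<and> (\<forall>w\<in>dsl_bf G D sbar. dsl_bf_cost G D sbar u \<le> dsl_bf_cost G D sbar w)"

definition RSA ::
  "('v, 'e) pre_digraph \<Rightarrow> ('v, 'x) demand_scheme set \<Rightarrow> nat \<Rightarrow> ('v, 'x, 'e) point set" where
  "RSA G D sbar = convex hull (dsl_bf G D sbar)"

text \<open>
  A linear inequality $l(u) \le b$ is passed on as its left-hand side $l$ and right-hand side $b$.
\<close>

definition valid_inequality ::
  "('v, 'e) pre_digraph \<Rightarrow> ('v, 'x) demand_scheme set \<Rightarrow> nat \<Rightarrow>
    (('v, 'x, 'e) point \<Rightarrow> real) \<Rightarrow> real \<Rightarrow> bool" where
  "valid_inequality G D sbar l b \<longleftrightarrow> (\<forall>u\<in>RSA G D sbar. l u \<le> b)"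

definition optimality_cut ::
  "('v, 'e) pre_digraph \<Rightarrow> ('v, 'x) demand_scheme set \<Rightarrow> nat \<Rightarrow>
    (('v, 'x, 'e) point \<Rightarrow> real) \<Rightarrow> real \<Rightarrow> bool" where
  "optimality_cut G D sbar l b \<longleftrightarrow>
    \<not> valid_inequality G D sbar l b \<and> (\<exists>u. dsl_bf_optimal G D sbar u \<and> l u \<le> b)"

text \<open>
  The library's \<^const>\<open>aff_dim\<close> and \<^term>\<open>(facet_of)\<close> require a Euclidean space. The following
  two definitions are the same ones for arbitrary real vector spaces. They are applied to subsets
  of a finite-dimensional subspace only, where the dimension is well defined (see below).
\<close>

definition affine_dim :: "'a::real_vector set \<Rightarrow> int" where
  "affine_dim V =
    (SOME d :: int.
      \<exists>B. affine hull B = affine hull V \<and> \<not> affine_dependent B \<and> int (card B) = d + 1)"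

definition is_facet_of :: "'a::real_vector set \<Rightarrow> 'a set \<Rightarrow> bool" where
  "is_facet_of F P \<longleftrightarrow> F face_of P \<and> F \<noteq> {} \<and> affine_dim F = affine_dim P - 1"

lemma affine_dim_eq_aff_dim: "affine_dim V = aff_dim V" for V :: "'a::euclidean_space set"
  unfolding affine_dim_def aff_dim_def by simp

lemma is_facet_of_iff_facet_of: "is_facet_of F P \<longleftrightarrow> F facet_of P" for P :: "'a::euclidean_space set"
  unfolding is_facet_of_def facet_of_def affine_dim_eq_aff_dim by simp

lemma affine_independent_card_le:
  fixes B C :: "'a::real_vector set"
  assumes B: "finite B" and C: "\<not> affine_dependent C" and hull: "affine hull C = affine hull B"
  shows "finite C \<and> card C \<le> card B"
proof (cases "C = {}")
  case False
  then obtain c where c: "c \<in> C" by blast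
  then have cB: "c \<in> affine hull B" unfolding hull[symmetric] by (rule hull_inc)
  then have "B \<noteq> {}" by auto
  then obtain b where b: "b \<in> B" by blast
  let ?W = "(\<lambda>x. -c + x) ` (C - {c})" and ?U = "(\<lambda>x. -b + x) ` (B - {b})"
  have ind: "independent ?W" using C c affine_dependent_iff_dependent2 by blast
  have V: "x - b \<in> span ?U" if "x \<in> affine hull B" for x
    using that unfolding affine_hull_span2[OF b] by auto
  have "?W \<subseteq> span ?U"
  proof (rule image_subsetI)
    fix x assume "x \<in> C - {c}"
    then have "x \<in> affine hull B" unfolding hull[symmetric] by (blast intro: hull_inc)
    from span_diff[OF V[OF this] V[OF cB]] show "-c + x \<in> span ?U" by simp
  qed
  moreover have "finite ?U" using B by blast
  ultimately have W: "finite ?W \<and> card ?W \<le> card ?U"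
    using real_vector.independent_span_bound[OF _ ind] by blast
  have cardW: "card ?W = card (C - {c})" by (rule card_image) (simp add: inj_on_def)
  have cardU: "card ?U = card (B - {b})" by (rule card_image) (simp add: inj_on_def)
  have "finite (C - {c})" 
    using finite_imageD[OF conjunct1[OF W]] by (simp add: inj_on_def)
  then have C: "finite C" by simp
  have "card C = Suc (card (C - {c}))" by (rule card.remove[OF C c])
  moreover have "card B = Suc (card (B - {b}))" by (rule card.remove[OF B b])
  ultimately show ?thesis using W cardW cardU C by linarith
qed simp

lemma affine_dim_unique:
  fixes B V :: "'a::real_vector set"
  assumes "finite B" "\<not> affine_dependent B" "affine hull B = affine hull V"
  shows "affine_dim V = int (card B) - 1"
  unfolding affine_dim_def
proof (rule some_equality)
  show "\<exists>A. affine hull A = affine hull V \<and> \<not> affine_dependent A \<and>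
      int (card A) = int (card B) - 1 + 1"
    using assms by auto
next
  fix d :: int
  assume "\<exists>A. affine hull A = affine hull V \<and> \<not> affine_dependent A \<and> int (card A) = d + 1"
  then obtain A where A: "affine hull A = affine hull V" "\<not> affine_dependent A"
    "int (card A) = d + 1" by blast
  have "finite A \<and> card A \<le> card B"
    using affine_independent_card_le[of B A] assms A by simp
  moreover from this have "card B \<le> card A"
    using affine_independent_card_le[of A B] assms A by simp
  ultimately show "d = int (card B) - 1" using A(3) by linarith
qed

definition induces_facet ::
  "('v, 'e) pre_digraph \<Rightarrow> ('v, 'x) demand_scheme set \<Rightarrow> nat \<Rightarrow>
    (('v, 'x, 'e) point \<Rightarrow> real) \<Rightarrow> real \<Rightarrow> bool" where
  "induces_facet G D sbar l b \<longleftrightarrow>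
    valid_inequality G D sbar l b \<and> is_facet_of {u \<in> RSA G D sbar. l u = b} (RSA G D sbar)"

definition linear_lhs ::
  "('v, 'e) pre_digraph \<Rightarrow> ('v, 'x) demand_scheme set \<Rightarrow> nat \<Rightarrow>
    (('v, 'x) demand_scheme \<Rightarrow> 'e \<Rightarrow> nat \<Rightarrow> real) \<Rightarrow> ('v, 'x, 'e) point \<Rightarrow> real" where
  "linear_lhs G D sbar a u = (\<Sum>d\<in>D. \<Sum>e\<in>arcs G. \<Sum>s\<in>{1..sbar}. a d e s * var u d e s)"

definition slot_symmetrical_lhs ::
  "('v, 'e) pre_digraph \<Rightarrow> ('v, 'x) demand_scheme set \<Rightarrow> nat \<Rightarrow>
    (('v, 'x) demand_scheme \<Rightarrow> 'e \<Rightarrow> nat \<Rightarrow> real) \<Rightarrow> ('v, 'x, 'e) point \<Rightarrow> real" where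
  "slot_symmetrical_lhs G D sbar a u =
    (\<Sum>d\<in>D. \<Sum>e\<in>arcs G. \<Sum>s\<in>{1..sbar}. a d e s * var u d e (sbar - s + 1))"

end

theory Submission
  imports Defs
begin

text \<open>
  Reversing the order of the slots is a linear involution of the space of the variables. It maps
  the feasible set onto itself: all constraints but (v) treat the slots alike, and for a binary
  \<open>u\<close> constraint (v) says that every maximal block of consecutive slots used by \<open>d\<close> on \<open>e\<close> has
  at least \<open>v(d)\<close> elements, a condition that does not depend on the direction in which the slots
  are read. It preserves the objective function, too, and an injective linear map preserves convex
  hulls, faces and dimensions.
\<close>

section \<open>Injective linear maps\<close>

text \<open>Both inclusions are minimality of the hull: preimages and images of affine sets under a
  linear map are affine.\<close>

lemma affine_hull_linear_image':
  assumes "linear f"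
  shows "f ` (affine hull S) = affine hull (f ` S)"
proof
  interpret f: linear f by fact
  have "affine {x. f x \<in> affine hull (f ` S)}"
    by (subst affine_def) (simp add: f.add f.scale mem_affine affine_affine_hull)
  then have "affine hull S \<subseteq> {x. f x \<in> affine hull (f ` S)}"
    by (intro hull_minimal) (auto intro: hull_inc)
  then show "f ` (affine hull S) \<subseteq> affine hull (f ` S)" by blast
  have "affine (f ` (affine hull S))"
  proof (subst affine_def, clarsimp simp: f.add[symmetric] f.scale[symmetric])
    fix x y and u v :: real
    assume "x \<in> affine hull S" "y \<in> affine hull S" "u + v = 1"
    then show "f (u *\<^sub>R x + v *\<^sub>R y) \<in> f ` (affine hull S)"
      by (intro imageI mem_affine affine_affine_hull)
  qed
  then show "affine hull (f ` S) \<subseteq> f ` (affine hull S)"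
    by (intro hull_minimal) (auto intro: hull_inc)
qed

lemma affine_dependent_inj_linear_image_iff:
  assumes "linear f" "inj f"
  shows "affine_dependent (f ` B) \<longleftrightarrow> affine_dependent B"
proof -
  have "f ` B - {f x} = f ` (B - {x})" for x
    using assms(2) by (auto dest: injD)
  then show ?thesis
    unfolding affine_dependent_def
    by (simp add: affine_hull_linear_image'[OF assms(1), symmetric] inj_image_mem_iff[OF assms(2)])
qed

text \<open>As \<open>affine_dim\<close> chooses some \<open>d\<close>, it suffices that the choice
  predicates of \<open>V\<close> and its image agree for every \<open>d\<close>: affine bases
  correspond under \<open>f\<close>.\<close>

lemma affine_dim_inj_linear_image:
  assumes f: "linear f" "inj f"
  shows "affine_dim (f ` V) = affine_dim V"
proof -
  have "(\<exists>B. affine hull B = affine hull (f ` V) \<and> \<not> affine_dependent B \<and> int (card B) = d + 1) \<longleftrightarrow>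
      (\<exists>B. affine hull B = affine hull V \<and> \<not> affine_dependent B \<and> int (card B) = d + 1)"
    (is "(\<exists>B. ?P B) \<longleftrightarrow> (\<exists>B. ?Q B)") for d
  proof -
    have image: "?P (f ` B) \<longleftrightarrow> ?Q B" for B
      using f by (simp add: affine_hull_linear_image'[symmetric] inj_image_eq_iff
          affine_dependent_inj_linear_image_iff card_image inj_on_subset[OF f(2)])
    \<comment> \<open>A basis of the image lies in the range of \<open>f\<close>, so it can be
      pulled back.\<close>
    have "\<exists>B'. B = f ` B'" if "?P B" for B
    proof -
      have "B \<subseteq> f ` (affine hull V)"
        using that hull_subset[of B affine] by (simp add: affine_hull_linear_image'[OF f(1)])
      then show ?thesis by (auto elim: subset_imageE)
    qed
    then show ?thesis using image by metis
  qed
  then show ?thesis unfolding affine_dim_def by simp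
qed

lemma is_facet_of_inj_linear_image:
  assumes "linear f" "inj f"
  shows "is_facet_of (f ` F) (f ` P) \<longleftrightarrow> is_facet_of F P"
  unfolding is_facet_of_def
  by (simp add: assms face_of_linear_image affine_dim_inj_linear_image)

section \<open>Blocks of consecutive slots\<close>

text \<open>Constraint (v) for one demand of volume \<open>v\<close> on one arc;
  \<open>x (n + 1)\<close> stands for the fictitious variable.\<close>

definition long_blocks :: "nat \<Rightarrow> nat \<Rightarrow> (nat \<Rightarrow> real) \<Rightarrow> bool" where
  "long_blocks n v x \<longleftrightarrow>
    (\<forall>s\<in>{1..n}. real v * (x s - x (s + 1)) \<le> (\<Sum>s'\<in>{max 1 (s + 1 - v)..s}. x s'))"

lemma long_blocks_cong:
  assumes "\<And>s. s \<in> {1..n + 1} \<Longrightarrow> x s = y s"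
  shows "long_blocks n v x \<longleftrightarrow> long_blocks n v y"
  unfolding long_blocks_def
proof (intro ball_cong refl)
  fix s assume s: "s \<in> {1..n}"
  have "(\<Sum>s'\<in>{max 1 (s + 1 - v)..s}. x s') = (\<Sum>s'\<in>{max 1 (s + 1 - v)..s}. y s')"
    using s by (intro sum.cong refl assms) auto
  moreover have "x s = y s" "x (s + 1) = y (s + 1)" using s by (auto intro: assms)
  ultimately show "real v * (x s - x (s + 1)) \<le> (\<Sum>s'\<in>{max 1 (s + 1 - v)..s}. x s') \<longleftrightarrow>
      real v * (y s - y (s + 1)) \<le> (\<Sum>s'\<in>{max 1 (s + 1 - v)..s}. y s')"
    by simp
qed

text \<open>The constraint bites only at the last slot of a block. There its left side is
  \<open>v\<close>, while the sum has at most \<open>v\<close> terms, each at most 1, so all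
  \<open>v\<close> of them must be present and equal to 1.\<close>

lemma long_blocks_iff:
  assumes x: "\<And>s. x s \<in> {0, 1}" and v: "v > 0"
  shows "long_blocks n v x \<longleftrightarrow>
    (\<forall>s\<in>{1..n}. x s = 1 \<longrightarrow> x (s + 1) = 0 \<longrightarrow> v \<le> s \<and> (\<forall>t\<in>{s + 1 - v..s}. x t = 1))"
proof -
  have nonneg: "0 \<le> x s" and le1: "x s \<le> 1" for s
    using x[of s] by auto
  have "real v * (x s - x (s + 1)) \<le> (\<Sum>s'\<in>{max 1 (s + 1 - v)..s}. x s') \<longleftrightarrow>
      (x s = 1 \<longrightarrow> x (s + 1) = 0 \<longrightarrow> v \<le> s \<and> (\<forall>t\<in>{s + 1 - v..s}. x t = 1))"
    (is "?L \<longleftrightarrow> ?R") if s: "s \<in> {1..n}" for s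
  proof (cases "x s = 1 \<and> x (s + 1) = 0")
    case False
    then have "x s - x (s + 1) \<le> 0" using x[of s] x[of "s + 1"] by auto
    then have "real v * (x s - x (s + 1)) \<le> 0" by (simp add: mult_nonneg_nonpos)
    also have "\<dots> \<le> (\<Sum>s'\<in>{max 1 (s + 1 - v)..s}. x s')" by (simp add: sum_nonneg nonneg)
    finally show ?thesis using False by blast
  next
    case True
    let ?A = "{max 1 (s + 1 - v)..s}"
    have le: "sum x ?A \<le> card ?A"
      using sum_bounded_above[of ?A x 1] le1 by simp
    show ?thesis
    proof
      assume L: ?L
      then have L': "real v \<le> sum x ?A" using True by simp
      with le have "v \<le> card ?A" by linarith
      \<comment> \<open>If \<open>v > s\<close>, the window would be cut off at slot 1 and have only
        \<open>s\<close> elements.\<close>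
      then have vs: "v \<le> s" using s v by (auto simp: max_def split: if_splits)
      have "x t = 1" if t: "t \<in> {s + 1 - v..s}" for t
      proof (rule ccontr)
        assume "x t \<noteq> 1"
        then have "x t = 0" using x[of t] by auto
        moreover have tA: "t \<in> ?A" using t vs s by auto
        ultimately have "sum x ?A = sum x (?A - {t})" by (simp add: sum.remove)
        also have "\<dots> \<le> card (?A - {t})" using sum_bounded_above[of "?A - {t}" x 1] le1 by simp
        finally have "real v \<le> card (?A - {t})" using L' by simp
        moreover have "card (?A - {t}) < card ?A" using tA by (intro card_Diff1_less) simp_all
        moreover have "card ?A = v" using vs by (simp add: max_absorb2 Suc_le_eq Suc_diff_le)
        ultimately show False by simp
      qed
      with vs show ?R by blast
    next
      assume ?R
      then have "v \<le> s" "\<And>t. t \<in> ?A \<Longrightarrow> x t = 1" using True by auto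
      moreover from this have "card ?A = v" by (simp add: max_absorb2 Suc_le_eq Suc_diff_le)
      moreover have "sum x ?A = (\<Sum>t\<in>?A. 1)" by (rule sum.cong) (use calculation in auto)
      ultimately show ?L using True by simp
    qed
  qed
  then show ?thesis unfolding long_blocks_def by simp
qed

text \<open>A block end of the reversed profile is a block beginning \<open>p\<close> of
  \<open>x\<close>. The constraint at the other end \<open>q\<close> of that block forces it to have
  at least \<open>v\<close> slots.\<close>

lemma long_blocks_reverse:
  assumes x: "\<And>s. x s \<in> {0, 1}" and v: "v > 0"
    and outside: "x 0 = 0" "\<And>s. s > n \<Longrightarrow> x s = 0"
    and long: "long_blocks n v x"
  shows "long_blocks n v (\<lambda>s. x (n + 1 - s))"
  unfolding long_blocks_iff[OF x v]
proof (intro ballI impI)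
  fix s assume s: "s \<in> {1..n}" and one: "x (n + 1 - s) = 1" and zero: "x (n + 1 - (s + 1)) = 0"
  define p where "p = n + 1 - s"
  have p: "p \<in> {1..n}" "x p = 1" "x (p - 1) = 0"
    using s one zero by (auto simp: p_def)
  text \<open>\<open>q\<close> is the last slot of the block that begins with \<open>p\<close>.\<close>
  define q where "q = (LEAST q. q \<ge> p \<and> x (q + 1) = 0)"
  \<comment> \<open>Slot \<open>n\<close> is a candidate because the fictitious slot after it is 0;
    hence the minimum exists and is at most \<open>n\<close>.\<close>
  have n: "n \<ge> p \<and> x (n + 1) = 0" using p outside(2) by simp
  have q: "q \<ge> p" "x (q + 1) = 0"
    using LeastI[of "\<lambda>q. q \<ge> p \<and> x (q + 1) = 0", OF n] unfolding q_def by blast+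
  have "q \<le> n"
    unfolding q_def by (rule Least_le[of "\<lambda>q. q \<ge> p \<and> x (q + 1) = 0", OF n])
  have block: "x t = 1" if "p \<le> t" "t \<le> q" for t
  proof (cases "t = p")
    case False
    \<comment> \<open>By minimality of \<open>q\<close>, the smaller slot \<open>t - 1\<close> is no
      candidate; since it is at least \<open>p\<close>, \<open>x t\<close> cannot be 0.\<close>
    then have "\<not> (t - 1 \<ge> p \<and> x (t - 1 + 1) = 0)"
      using that not_less_Least[of "t - 1" "\<lambda>q. q \<ge> p \<and> x (q + 1) = 0"]
      unfolding q_def by linarith
    then show ?thesis using that False x[of t] by auto
  qed (use p in simp)
  have "q \<in> {1..n}" using p q(1) \<open>q \<le> n\<close> by simp
  then have "v \<le> q" and last: "\<And>t. t \<in> {q + 1 - v..q} \<Longrightarrow> x t = 1"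
    using long q(2) block[OF q(1) order_refl] unfolding long_blocks_iff[OF x v] by blast+
  \<comment> \<open>The \<open>v\<close> ones ending at \<open>q\<close> avoid the zero at
    \<open>p - 1\<close>, so they all fit between \<open>p\<close> and \<open>q\<close>.\<close>
  have "p - 1 \<notin> {q + 1 - v..q}" using last[of "p - 1"] p(3) by auto
  then have len: "p + v \<le> q + 1" using q(1) p(1) by auto
  \<comment> \<open>For \<open>t\<close> in this window, \<open>n + 1 - t\<close> runs from
    \<open>p\<close> to \<open>p + v - 1\<close>, which is at most \<open>q\<close>.\<close>
  show "v \<le> s \<and> (\<forall>t\<in>{s + 1 - v..s}. x (n + 1 - t) = 1)"
  proof
    show "v \<le> s" using len \<open>q \<le> n\<close> s unfolding p_def by auto
    show "\<forall>t\<in>{s + 1 - v..s}. x (n + 1 - t) = 1"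
      using len \<open>q \<le> n\<close> s \<open>v \<le> s\<close> unfolding p_def
      by (intro ballI block) (auto simp: p_def)
  qed
qed

section \<open>Reversing the slots\<close>

text \<open>Slots outside \<open>{1..n}\<close> stay fixed, which makes the map an involution on all
  keys and hence injective, as \<open>map_key\<close> requires.\<close>

definition reverse_slot :: "nat \<Rightarrow> 'd \<times> 'e \<times> nat \<Rightarrow> 'd \<times> 'e \<times> nat" where
  "reverse_slot n = (\<lambda>(d, e, s). (d, e, if s \<in> {1..n} then n + 1 - s else s))"

lemma reverse_slot_reverse_slot [simp]: "reverse_slot n (reverse_slot n k) = k"
  by (cases k) (auto simp: reverse_slot_def)

lemma inj_reverse_slot: "inj (reverse_slot n)"
  by (metis injI reverse_slot_reverse_slot)

lemma lookup_scaleR: "Poly_Mapping.lookup (c *\<^sub>R u) k = c *\<^sub>R Poly_Mapping.lookup u k"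
proof -
  have "finite {k. c *\<^sub>R Poly_Mapping.lookup u k \<noteq> 0}"
    by (rule finite_subset[OF _ finite_keys[of u]]) (auto simp: in_keys_iff)
  then show ?thesis by (simp add: scaleR_poly_mapping_def lookup_Abs_poly_mapping)
qed

definition reverse_slots :: "nat \<Rightarrow> ('v, 'x, 'e) point \<Rightarrow> ('v, 'x, 'e) point" where
  "reverse_slots n = Poly_Mapping.map_key (reverse_slot n)"

lemma lookup_reverse_slots:
  "Poly_Mapping.lookup (reverse_slots n u) k = Poly_Mapping.lookup u (reverse_slot n k)"
  unfolding reverse_slots_def by (simp add: map_key.rep_eq[OF inj_reverse_slot])

lemma reverse_slots_reverse_slots [simp]: "reverse_slots n (reverse_slots n u) = u"
  by (rule poly_mapping_eqI) (simp add: lookup_reverse_slots)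

lemma inj_reverse_slots: "inj (reverse_slots n)"
  by (metis injI reverse_slots_reverse_slots)

lemma linear_reverse_slots: "linear (reverse_slots n)"
proof (rule linearI)
  show "reverse_slots n (u + w) = reverse_slots n u + reverse_slots n w" for u w
    by (rule poly_mapping_eqI) (simp add: lookup_reverse_slots lookup_add)
  show "reverse_slots n (c *\<^sub>R u) = c *\<^sub>R reverse_slots n u" for c u
    by (rule poly_mapping_eqI) (simp add: lookup_reverse_slots lookup_scaleR)
qed

lemma var_reverse_slots: "s \<in> {1..n} \<Longrightarrow> var (reverse_slots n u) d e s = var u d e (n + 1 - s)"
  by (simp add: lookup_reverse_slots reverse_slot_def)

text \<open>The function \<open>h\<close> lets one reindexing serve both the plain sums in the
  constraints and the scaled sums in the cost.\<close>

lemma sum_reverse_slots: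
  "(\<Sum>s\<in>{1..n}. h (var (reverse_slots n u) d e s)) = (\<Sum>s\<in>{1..n}. h (var u d e s))"
proof -
  have "(\<Sum>s\<in>{1..n}. h (var (reverse_slots n u) d e s)) = (\<Sum>s\<in>{1..n}. h (var u d e (n + 1 - s)))"
    by (intro sum.cong refl) (simp add: var_reverse_slots)
  also have "\<dots> = (\<Sum>s\<in>{1..n}. h (var u d e s))"
    using sum.atLeastAtMost_rev[of "\<lambda>s. h (var u d e s)" 1 n] by (simp add: add.commute)
  finally show ?thesis .
qed

text \<open>Substituting \<open>n + 1 - s\<close> for the slot is composition with the involution;
  every transfer below rests on this.\<close>

lemma slot_symmetrical_lhs_eq:
  "slot_symmetrical_lhs G D n a u = linear_lhs G D n a (reverse_slots n u)"
  unfolding slot_symmetrical_lhs_def linear_lhs_def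
  by (intro sum.cong refl) (simp add: var_reverse_slots Suc_diff_le)

section \<open>Invariance of the objective, the feasible set and the polytope\<close>

lemma dsl_bf_cost_reverse_slots: "dsl_bf_cost G D n (reverse_slots n u) = dsl_bf_cost G D n u"
  unfolding dsl_bf_cost_def
  by (intro sum.cong[OF refl] sum_reverse_slots)

lemma var_dsl_bf_outside:
  assumes "u \<in> dsl_bf G D n" "\<not> (d \<in> D \<and> e \<in> arcs G \<and> s \<in> {1..n})"
  shows "var u d e s = 0"
proof -
  have "(d, e, s) \<notin> Poly_Mapping.keys u" using assms unfolding dsl_bf_def by auto
  then show ?thesis by (simp add: in_keys_iff)
qed

lemma var_dsl_bf_binary:
  assumes "u \<in> dsl_bf G D n"
  shows "var u d e s \<in> {0, 1}"
proof (cases "d \<in> D \<and> e \<in> arcs G \<and> s \<in> {1..n}")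
  case True
  then show ?thesis using assms unfolding dsl_bf_def by blast
next
  case False
  then show ?thesis using var_dsl_bf_outside[OF assms] by blast
qed

text \<open>Constraints (i) and (iv) at \<open>s\<close> are those of \<open>u\<close> at
  \<open>n + 1 - s\<close>; (ii) and (iii) sum over all slots; (v) is
  \<open>long_blocks_reverse\<close>.\<close>

lemma reverse_slots_dsl_bf:
  assumes "rsa_instance G D" and u: "u \<in> dsl_bf G D n"
  shows "reverse_slots n u \<in> dsl_bf G D n"
proof -
  interpret rsa_instance G D by fact
  let ?w = "reverse_slots n u"
  have slot: "n + 1 - s \<in> {1..n}" if "s \<in> {1..n}" for s using that by auto
  have w0: "var ?w d e (n + 1) = 0" for d e
    using var_dsl_bf_outside[OF u, of d e "n + 1"] by (simp add: lookup_reverse_slots reverse_slot_def)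
  have sums: "(\<Sum>e\<in>A. \<Sum>s\<in>{1..n}. var ?w d e s) = (\<Sum>e\<in>A. \<Sum>s\<in>{1..n}. var u d e s)" for d A
    by (intro sum.cong[OF refl] sum_reverse_slots)
  have "Poly_Mapping.keys ?w \<subseteq> D \<times> arcs G \<times> {1..n}"
  proof
    fix k assume k: "k \<in> Poly_Mapping.keys ?w"
    then have "reverse_slot n k \<in> Poly_Mapping.keys u"
      by (simp add: in_keys_iff lookup_reverse_slots)
    then have "reverse_slot n k \<in> D \<times> arcs G \<times> {1..n}" using u unfolding dsl_bf_def by blast
    then show "k \<in> D \<times> arcs G \<times> {1..n}"
      by (cases k) (auto simp: reverse_slot_def split: if_splits)
  qed
  moreover have "real (volume d) * (var ?w d e s - var ?w d e (s + 1))
      \<le> (\<Sum>s'\<in>{max 1 (s + 1 - volume d)..s}. var ?w d e s')"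
    if d: "d \<in> D" and e: "e \<in> arcs G" and s: "s \<in> {1..n}" for d e s
  proof -
    have "long_blocks n (volume d) (\<lambda>s. var u d e s)"
      using u d e unfolding dsl_bf_def long_blocks_def by blast
    then have "long_blocks n (volume d) (\<lambda>s. var u d e (n + 1 - s))"
      by (rule long_blocks_reverse[rotated -1])
        (use var_dsl_bf_binary[OF u] volume_pos[OF d] var_dsl_bf_outside[OF u] in auto)
    \<comment> \<open>At \<open>s = n + 1\<close> the left side reads slot 0 and the right side the
      fixed fictitious slot; both are 0.\<close>
    moreover have "var u d e (n + 1 - s) = var ?w d e s" if "s \<in> {1..n + 1}" for s
      using that w0[of d e] var_dsl_bf_outside[OF u, of d e 0] var_reverse_slots[of s n u d e]
      by (cases "s = n + 1") auto
    ultimately have "long_blocks n (volume d) (\<lambda>s. var ?w d e s)"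
      using long_blocks_cong[of n "\<lambda>s. var u d e (n + 1 - s)" "\<lambda>s. var ?w d e s"] by blast
    then show ?thesis using s unfolding long_blocks_def by blast
  qed
  moreover have "(\<Sum>e\<in>in_arcs G j. var ?w d e s) - (\<Sum>e\<in>out_arcs G j. var ?w d e s) = 0"
    if "d \<in> D" "j \<in> verts G - {source d, target d}" "s \<in> {1..n}" for d j s
    using u that slot[of s] unfolding dsl_bf_def by (simp add: var_reverse_slots)
  moreover have "(\<Sum>d\<in>D. var ?w d e s) \<le> 1" if "e \<in> arcs G" "s \<in> {1..n}" for e s
    using u that slot[of s] unfolding dsl_bf_def by (simp add: var_reverse_slots)
  moreover have "var ?w d e s \<in> {0, 1}" for d e s
    using var_dsl_bf_binary[OF u] by (simp add: lookup_reverse_slots reverse_slot_def)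
  moreover have "\<forall>d\<in>D. (\<Sum>e\<in>out_arcs G (source d). \<Sum>s\<in>{1..n}. var ?w d e s) \<ge> real (volume d)"
    "\<forall>d\<in>D. (\<Sum>e\<in>in_arcs G (source d). \<Sum>s\<in>{1..n}. var ?w d e s) = 0"
    unfolding sums using u unfolding dsl_bf_def by blast+
  ultimately show ?thesis unfolding dsl_bf_def mem_Collect_eq by (intro conjI ballI) blast+
qed

lemma reverse_slots_RSA:
  assumes "rsa_instance G D"
  shows "reverse_slots n ` RSA G D n = RSA G D n"
proof -
  have "reverse_slots n ` dsl_bf G D n = dsl_bf G D n"
  proof
    show "reverse_slots n ` dsl_bf G D n \<subseteq> dsl_bf G D n"
      using reverse_slots_dsl_bf[OF assms] by blast
    \<comment> \<open>Each feasible point is the image of its own reversal.\<close>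
    show "dsl_bf G D n \<subseteq> reverse_slots n ` dsl_bf G D n"
      using reverse_slots_dsl_bf[OF assms] by (metis image_eqI reverse_slots_reverse_slots subsetI)
  qed
  then show ?thesis
    unfolding RSA_def by (simp add: convex_hull_linear_image[OF linear_reverse_slots])
qed

lemma reverse_slots_in_RSA:
  "rsa_instance G D \<Longrightarrow> u \<in> RSA G D n \<Longrightarrow> reverse_slots n u \<in> RSA G D n"
  using reverse_slots_RSA by blast

lemma dsl_bf_optimal_reverse_slots:
  assumes "rsa_instance G D" "dsl_bf_optimal G D n u"
  shows "dsl_bf_optimal G D n (reverse_slots n u)"
  using assms(2) reverse_slots_dsl_bf[OF assms(1)]
  unfolding dsl_bf_optimal_def dsl_bf_cost_reverse_slots by blast

section \<open>Transfer of valid inequalities, optimality cuts and facets\<close>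

text \<open>Stated as an equivalence because an optimality cut must also stay invalid.\<close>

lemma valid_inequality_slot_symmetrical:
  assumes "rsa_instance G D"
  shows "valid_inequality G D n (slot_symmetrical_lhs G D n a) b \<longleftrightarrow>
    valid_inequality G D n (linear_lhs G D n a) b"
proof -
  have "valid_inequality G D n (linear_lhs G D n a) b \<longleftrightarrow>
      (\<forall>u\<in>reverse_slots n ` RSA G D n. linear_lhs G D n a u \<le> b)"
    unfolding valid_inequality_def reverse_slots_RSA[OF assms] ..
  then show ?thesis by (simp add: valid_inequality_def slot_symmetrical_lhs_eq)
qed

text \<open>The witness is the reversal of an optimal solution satisfying the original cut;
  reversing twice restores the value of the left-hand side.\<close>

lemma optimality_cut_slot_symmetrical:
  assumes "rsa_instance G D" "optimality_cut G D n (linear_lhs G D n a) b"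
  shows "optimality_cut G D n (slot_symmetrical_lhs G D n a) b"
  using assms dsl_bf_optimal_reverse_slots reverse_slots_reverse_slots
  unfolding optimality_cut_def valid_inequality_slot_symmetrical[OF assms(1)] slot_symmetrical_lhs_eq
  by metis

text \<open>The new face is the image of the old one under an injective linear map that sends the
  polytope onto itself.\<close>

lemma induces_facet_slot_symmetrical:
  assumes "rsa_instance G D" "induces_facet G D n (linear_lhs G D n a) b"
  shows "induces_facet G D n (slot_symmetrical_lhs G D n a) b"
proof -
  let ?F = "{u \<in> RSA G D n. linear_lhs G D n a u = b}"
  have "{u \<in> RSA G D n. slot_symmetrical_lhs G D n a u = b} = reverse_slots n ` ?F"
    (is "?F' = _")
  proof
    show "reverse_slots n ` ?F \<subseteq> ?F'"
      by (auto simp: slot_symmetrical_lhs_eq reverse_slots_in_RSA[OF assms(1)])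
    show "?F' \<subseteq> reverse_slots n ` ?F"
    proof
      fix u assume "u \<in> ?F'"
      then have "reverse_slots n u \<in> ?F"
        by (simp add: slot_symmetrical_lhs_eq reverse_slots_in_RSA[OF assms(1)])
      then show "u \<in> reverse_slots n ` ?F" by (rule rev_image_eqI) simp
    qed
  qed
  moreover have "is_facet_of (reverse_slots n ` ?F) (reverse_slots n ` RSA G D n)"
    using assms(2) unfolding induces_facet_def
    by (simp add: is_facet_of_inj_linear_image[OF linear_reverse_slots inj_reverse_slots])
  ultimately show ?thesis
    using assms unfolding induces_facet_def
    by (simp add: valid_inequality_slot_symmetrical reverse_slots_RSA)
qed

theorem theorem1:
  fixes G :: "('v, 'e) pre_digraph"
    and D :: "('v, 'x) demand_scheme set"
    and sbar :: nat
    and a :: "('v, 'x) demand_scheme \<Rightarrow> 'e \<Rightarrow> nat \<Rightarrow> real"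
    and b :: real
  assumes "rsa_instance G D"
  shows "(valid_inequality G D sbar (linear_lhs G D sbar a) b \<longrightarrow>
            valid_inequality G D sbar (slot_symmetrical_lhs G D sbar a) b) \<and>
         (optimality_cut G D sbar (linear_lhs G D sbar a) b \<longrightarrow>
            optimality_cut G D sbar (slot_symmetrical_lhs G D sbar a) b) \<and>
         (induces_facet G D sbar (linear_lhs G D sbar a) b \<longrightarrow>
            induces_facet G D sbar (slot_symmetrical_lhs G D sbar a) b)"
  using assms valid_inequality_slot_symmetrical optimality_cut_slot_symmetrical
    induces_facet_slot_symmetrical by blast

end
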